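(* Let $L$ be a compact metric space. Let $\mathcal{X}$ be a uniformly totally bounded set of compact $L$-labeled metric spaces. Suppose that for every $\ell\in L$ and $\varepsilon>0$ there exists a neighborhood $U_\ell\subseteq L$ of $\ell$ such that for every $\ell'\in U_\ell$ and $(X,\alpha)\in\mathcal{X}$ we have $d_X(\alpha(\ell),\alpha(\ell'))<\varepsilon$. Then $\mathcal{X}$ is precompact in $\mathcal{M}_L$.
   Context: All metric spaces are assumed to be compact. Given a set $L$, an $L$-labeled metric space is a pair $(X,\alpha)$ where $X$ is a (compact) metric space and $\alpha\colon L\to X$ is an arbitrary map (a labeling). For $L$-labeled metric spaces $(X,\alpha)$, $(Y,\beta)$ and $t\ge 0$, a pseudometric $d\colon (X\sqcup Y)^2\to[0,\infty)$ on the disjoint union is called $(t,L)$-admissible if (1) $d|_{X\times X}=d_X$ and $d|_{Y\times Y}=d_Y$; (2) $d_H(X,Y)\le t$, where $d_H$ is the Hausdorff distance with respect to $d$; (3) $\sup_{\ell\in L}d(\alpha(\ell),\beta(\ell))\le t$ (with $\sup\varnothing=0$). The labeled Gromov-Hausdorff (LGH) distance is $$d_{GH}^L(X,\alpha;Y,\beta):=\inf\{t : \text{there exists a } (t,L)\text{-admissible pseudometric on } X\sqcup Y\}.$$ $(X,\alpha)$ and $(Y,\beta)$ are $L$-isometric if there is a (bijective) isometry $h\colon X\to Y$ with $h(\alpha(\ell))=\beta(\ell)$ for all $\ell\in L$. $\mathcal{M}_L$ denotes the set of all $L$-isometry classes, with the metric induced by $d_{GH}^L$; labeled metric spaces are regarded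 as points of $\mathcal{M}_L$. Precompact means that every sequence in the set has a subsequence converging in $\mathcal{M}_L$. A collection of metric spaces is uniformly totally bounded if (1) there is a constant $d>0$ such that $\operatorname{diam}X\le d$ for all $X$ in the collection, and (2) for any $\varepsilon>0$ there is $N_\varepsilon\in\mathbb{N}$ such that any $X$ in the collection has an $\varepsilon$-net consisting of at most $N_\varepsilon$ points (an $\varepsilon$-net being a subset $S\subseteq X$ such that every point of $X$ is at distance less than $\varepsilon$ from some point of $S$). A set of $L$-labeled metric spaces is uniformly totally bounded if the collection of its underlying metric spaces is. *)

theory Defs
  imports "HOL-Analysis.Analysis"
begin

section \<open>Labeled metric spaces\<close>

text \<open>
  A labeled metric space is a pair \<open>(X, \<alpha>)\<close>. The label set \<open>L\<close> is a set over the type \<open>'l\<close>; the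
  values of \<open>\<alpha>\<close> outside \<open>L\<close> carry no meaning, and nothing below depends on them.
  The empty metric space is admitted (it can carry a labeling only when \<open>L\<close> is empty).
\<close>

type_synonym ('l, 'a) labeled_space = "'a metric \<times> ('l \<Rightarrow> 'a)"

definition labeled_metric_space :: "'l set \<Rightarrow> ('l, 'a) labeled_space \<Rightarrow> bool" where
  "labeled_metric_space L = (\<lambda>(X, \<alpha>).
     compact_space (mtopology_of X) \<and> (\<forall>l\<in>L. \<alpha> l \<in> mspace X))"

definition L_isometric ::
    "'l set \<Rightarrow> ('l, 'a) labeled_space \<Rightarrow> ('l, 'b) labeled_space \<Rightarrow> bool" where
  "L_isometric L = (\<lambda>(X, \<alpha>) (Y, \<beta>).
     \<exists>h. bij_betw h (mspace X) (mspace Y) \<and>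
         (\<forall>x\<in>mspace X. \<forall>y\<in>mspace X. mdist Y (h x) (h y) = mdist X x y) \<and>
         (\<forall>l\<in>L. h (\<alpha> l) = \<beta> l))"


section \<open>The labeled Gromov--Hausdorff distance\<close>

definition pseudometric_on :: "'a set \<Rightarrow> ('a \<Rightarrow> 'a \<Rightarrow> real) \<Rightarrow> bool" where
  "pseudometric_on S d \<longleftrightarrow>
     (\<forall>x\<in>S. \<forall>y\<in>S. 0 \<le> d x y) \<and>
     (\<forall>x\<in>S. d x x = 0) \<and>
     (\<forall>x\<in>S. \<forall>y\<in>S. d x y = d y x) \<and>
     (\<forall>x\<in>S. \<forall>y\<in>S. \<forall>z\<in>S. d x z \<le> d x y + d y z)"

text \<open>
  The values are extended nonnegative reals, so that suprema and infima over empty sets are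
  \<open>0\<close> and \<open>\<infinity>\<close>.
\<close>

definition hausdorff_dist :: "('a \<Rightarrow> 'a \<Rightarrow> real) \<Rightarrow> 'a set \<Rightarrow> 'a set \<Rightarrow> ennreal" where
  "hausdorff_dist d A B =
     max (SUP a\<in>A. INF b\<in>B. ennreal (d a b)) (SUP b\<in>B. INF a\<in>A. ennreal (d a b))"

definition lgh_admissible ::
    "real \<Rightarrow> 'l set \<Rightarrow> ('l, 'a) labeled_space \<Rightarrow> ('l, 'b) labeled_space
      \<Rightarrow> ('a + 'b \<Rightarrow> 'a + 'b \<Rightarrow> real) \<Rightarrow> bool" where
  "lgh_admissible t L = (\<lambda>(X, \<alpha>) (Y, \<beta>) d.
     pseudometric_on (mspace X <+> mspace Y) d \<and>
     (\<forall>x\<in>mspace X. \<forall>x'\<in>mspace X. d (Inl x) (Inl x') = mdist X x x') \<and>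
     (\<forall>y\<in>mspace Y. \<forall>y'\<in>mspace Y. d (Inr y) (Inr y') = mdist Y y y') \<and>
     hausdorff_dist d (Inl ` mspace X) (Inr ` mspace Y) \<le> ennreal t \<and>
     (SUP l\<in>L. ennreal (d (Inl (\<alpha> l)) (Inr (\<beta> l)))) \<le> ennreal t)"

text \<open>
  The value \<open>\<infinity>\<close> (no admissible pseudometric for any \<open>t\<close>) occurs, among compact spaces, only
  between the empty space and a nonempty one.
\<close>

definition lgh_dist ::
    "'l set \<Rightarrow> ('l, 'a) labeled_space \<Rightarrow> ('l, 'b) labeled_space \<Rightarrow> ennreal" where
  "lgh_dist L P Q = Inf {ennreal t | t. 0 \<le> t \<and> (\<exists>d. lgh_admissible t L P Q d)}"


section \<open>The space of isometry classes\<close>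

text \<open>
  Isometry classes are formed from the spaces whose points have type \<open>nat \<Rightarrow> real\<close>. No class is
  lost: the map \<open>x \<mapsto> (n \<mapsto> d(x, x\<^sub>n))\<close>, for a dense sequence \<open>(x\<^sub>n)\<close>, embeds every compact metric
  space over any type into this type (lemma \<open>L_isometric_universe\<close>).
\<close>

type_synonym 'l universal_space = "('l, nat \<Rightarrow> real) labeled_space"

definition LGH_space :: "'l set \<Rightarrow> 'l universal_space set set" where
  "LGH_space L = {P. labeled_metric_space L P} //
     {(P, Q). labeled_metric_space L P \<and> labeled_metric_space L Q \<and> L_isometric L P Q}"

text \<open>
  By lemma \<open>LGH_space_dist_class\<close> the choice of representatives is immaterial.
\<close>

definition LGH_space_dist ::
    "'l set \<Rightarrow> 'l universal_space set \<Rightarrow> 'l universal_space set \<Rightarrow> ennreal" where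
  "LGH_space_dist L C D = lgh_dist L (SOME P. P \<in> C) (SOME Q. Q \<in> D)"

definition LGH_class :: "'l set \<Rightarrow> ('l, 'a) labeled_space \<Rightarrow> 'l universal_space set" where
  "LGH_class L P = {Q. labeled_metric_space L Q \<and> L_isometric L P Q}"

definition LGH_precompact :: "'l set \<Rightarrow> 'l universal_space set set \<Rightarrow> bool" where
  "LGH_precompact L S \<longleftrightarrow> S \<subseteq> LGH_space L \<and>
     (\<forall>\<sigma>. range \<sigma> \<subseteq> S \<longrightarrow>
        (\<exists>(r :: nat \<Rightarrow> nat) C. strict_mono r \<and> C \<in> LGH_space L \<and>
           (\<lambda>n. LGH_space_dist L (\<sigma> (r n)) C) \<longlonglongrightarrow> 0))"


section \<open>Uniform total boundedness\<close>

definition mdiam :: "'a metric \<Rightarrow> ennreal" where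
  "mdiam X = (SUP x\<in>mspace X. SUP y\<in>mspace X. ennreal (mdist X x y))"

definition eps_net :: "'a metric \<Rightarrow> real \<Rightarrow> 'a set \<Rightarrow> bool" where
  "eps_net X \<epsilon> S \<longleftrightarrow> S \<subseteq> mspace X \<and> (\<forall>x\<in>mspace X. \<exists>s\<in>S. mdist X x s < \<epsilon>)"

definition uniformly_totally_bounded :: "'a metric set \<Rightarrow> bool" where
  "uniformly_totally_bounded \<C> \<longleftrightarrow>
     (\<exists>d>0. \<forall>X\<in>\<C>. mdiam X \<le> ennreal d) \<and>
     (\<forall>\<epsilon>>0. \<exists>N::nat. \<forall>X\<in>\<C>. \<exists>S. eps_net X \<epsilon> S \<and> finite S \<and> card S \<le> N)"


section \<open>Adequacy of the definitions\<close>

lemma L_isometric_refl: "L_isometric L P P"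
  unfolding L_isometric_def by (auto intro!: exI[of _ id] split: prod.splits)

lemma L_isometric_sym:
  assumes "labeled_metric_space L P" and "L_isometric L P Q"
  shows "L_isometric L Q P"
proof -
  obtain X \<alpha> Y \<beta> where PQ: "P = (X, \<alpha>)" "Q = (Y, \<beta>)" by (cases P, cases Q) auto
  obtain h where h: "bij_betw h (mspace X) (mspace Y)"
      "\<And>x y. x \<in> mspace X \<Longrightarrow> y \<in> mspace X \<Longrightarrow> mdist Y (h x) (h y) = mdist X x y"
      "\<And>l. l \<in> L \<Longrightarrow> h (\<alpha> l) = \<beta> l"
    using assms(2) unfolding PQ L_isometric_def by auto
  have \<alpha>: "\<And>l. l \<in> L \<Longrightarrow> \<alpha> l \<in> mspace X"
    using assms(1) unfolding PQ labeled_metric_space_def by auto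
  define g where "g = inv_into (mspace X) h"
  have g: "bij_betw g (mspace Y) (mspace X)"
    unfolding g_def by (rule bij_betw_inv_into[OF h(1)])
  have hg: "\<And>y. y \<in> mspace Y \<Longrightarrow> h (g y) = y"
    unfolding g_def by (rule bij_betw_inv_into_right[OF h(1)])
  have "mdist X (g x) (g y) = mdist Y x y" if "x \<in> mspace Y" "y \<in> mspace Y" for x y
    using h(2)[of "g x" "g y"] that hg bij_betwE[OF g] by simp
  moreover have "g (\<beta> l) = \<alpha> l" if "l \<in> L" for l
    using h(3)[OF that] bij_betw_inv_into_left[OF h(1) \<alpha>[OF that]] by (simp add: g_def)
  ultimately show ?thesis
    unfolding PQ L_isometric_def using g by auto
qed

lemma L_isometric_trans:
  assumes "labeled_metric_space L P" and "L_isometric L P Q" and "L_isometric L Q R"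
  shows "L_isometric L P R"
proof -
  obtain X \<alpha> Y \<beta> Z \<gamma> where PQ: "P = (X, \<alpha>)" "Q = (Y, \<beta>)" "R = (Z, \<gamma>)"
    by (cases P, cases Q, cases R) auto
  obtain h where h: "bij_betw h (mspace X) (mspace Y)"
      "\<And>x y. x \<in> mspace X \<Longrightarrow> y \<in> mspace X \<Longrightarrow> mdist Y (h x) (h y) = mdist X x y"
      "\<And>l. l \<in> L \<Longrightarrow> h (\<alpha> l) = \<beta> l"
    using assms(2) unfolding PQ L_isometric_def by auto
  obtain k where k: "bij_betw k (mspace Y) (mspace Z)"
      "\<And>x y. x \<in> mspace Y \<Longrightarrow> y \<in> mspace Y \<Longrightarrow> mdist Z (k x) (k y) = mdist Y x y"
      "\<And>l. l \<in> L \<Longrightarrow> k (\<beta> l) = \<gamma> l"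
    using assms(3) unfolding PQ L_isometric_def by auto
  show ?thesis
    unfolding PQ L_isometric_def prod.case
    by (rule exI[of _ "k \<circ> h"])
       (use h k bij_betw_trans[OF h(1) k(1)] bij_betwE[OF h(1)] in auto)
qed

lemma LGH_equiv:
  "equiv {P. labeled_metric_space L P}
     {(P, Q). labeled_metric_space L P \<and> labeled_metric_space L Q \<and>
        L_isometric L P (Q :: ('l, 'a) labeled_space)}"
proof (rule equivI)
  show "refl_on {P. labeled_metric_space L P}
     {(P, Q). labeled_metric_space L P \<and> labeled_metric_space L Q \<and>
        L_isometric L P (Q :: ('l, 'a) labeled_space)}"
    by (auto simp: refl_on_def L_isometric_refl)
  show "sym {(P, Q). labeled_metric_space L P \<and> labeled_metric_space L Q \<and>
        L_isometric L P (Q :: ('l, 'a) labeled_space)}"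
    unfolding sym_def mem_Collect_eq prod.case by (meson L_isometric_sym)
  show "trans {(P, Q). labeled_metric_space L P \<and> labeled_metric_space L Q \<and>
        L_isometric L P (Q :: ('l, 'a) labeled_space)}"
    unfolding trans_def mem_Collect_eq prod.case by (meson L_isometric_trans)
qed auto

lemma compact_metric_inj_sequences:
  assumes "compact_space (mtopology_of X)"
  shows "\<exists>f :: 'a \<Rightarrow> nat \<Rightarrow> real. inj_on f (mspace (X :: 'a metric))"
proof (cases "mspace X = {}")
  case True
  then show ?thesis by simp
next
  case False
  interpret Metric_space "mspace X" "mdist X" by (rule Metric_space_mspace_mdist)
  have tb: "mtotally_bounded (mspace X)"
    using assms compactin_imp_mtotally_bounded
    by (simp add: mtopology_of_def compact_space_def)
  have "\<exists>K. finite K \<and> K \<subseteq> mspace X \<and> mspace X \<subseteq> (\<Union>x\<in>K. mball x (1 / Suc n))" for n :: nat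
    using tb unfolding mtotally_bounded_def by simp
  then obtain K where K: "\<And>n::nat. finite (K n)" "\<And>n. K n \<subseteq> mspace X"
      "\<And>n. mspace X \<subseteq> (\<Union>x\<in>K n. mball x (1 / Suc n))"
    by metis
  define D where "D = (\<Union>n. K n)"
  have cD: "countable D" unfolding D_def using K(1) by (auto intro: countable_finite)
  have "K 0 \<noteq> {}" using K(3)[of 0] False by auto
  then have "D \<noteq> {}" unfolding D_def by auto
  then have rD: "range (from_nat_into D) = D" using cD by (rule range_from_nat_into)
  have "x = y" if xy: "x \<in> mspace X" "y \<in> mspace X"
    and eq: "(\<lambda>n. mdist X x (from_nat_into D n)) = (\<lambda>n. mdist X y (from_nat_into D n))" for x y
  proof (rule ccontr)
    assume "x \<noteq> y"
    then have "mdist X x y / 2 > 0" using xy by simp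
    then obtain n :: nat where n: "1 / Suc n < mdist X x y / 2"
      using nat_approx_posE by blast
    obtain s where s: "s \<in> K n" "mdist X s x < 1 / Suc n"
      using K(3)[of n] xy by auto
    have "s \<in> D" using s by (auto simp: D_def)
    then obtain m where "s = from_nat_into D m" using rD by (metis imageE)
    then have "mdist X x s = mdist X y s" using fun_cong[OF eq, of m] by simp
    moreover have "mdist X x y \<le> mdist X x s + mdist X y s"
      using triangle'[of x s y] xy s(1) K(2)[of n] by blast
    moreover have "mdist X x s = mdist X s x" by (rule commute)
    ultimately show False using n s(2) by linarith
  qed
  then show ?thesis
    by (intro exI[of _ "\<lambda>x n. mdist X x (from_nat_into D n)"] inj_onI)
qed

lemma L_isometric_universe:
  assumes "labeled_metric_space L P"
  shows "\<exists>Q :: 'l universal_space. labeled_metric_space L Q \<and> L_isometric L P Q"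
proof -
  obtain X \<alpha> where P: "P = (X, \<alpha>)" by (cases P)
  have cX: "compact_space (mtopology_of X)" and \<alpha>: "\<And>l. l \<in> L \<Longrightarrow> \<alpha> l \<in> mspace X"
    using assms by (auto simp: P labeled_metric_space_def)
  obtain f :: "_ \<Rightarrow> nat \<Rightarrow> real" where f: "inj_on f (mspace X)"
    using compact_metric_inj_sequences[OF cX] by blast
  define g where "g = inv_into (mspace X) f"
  have gf: "\<And>x. x \<in> mspace X \<Longrightarrow> g (f x) = x" by (simp add: g_def f)
  define M where "M = f ` mspace X"
  define e where "e = (\<lambda>u v. mdist X (g u) (g v))"
  interpret X: Metric_space "mspace X" "mdist X" by (rule Metric_space_mspace_mdist)
  have M: "Metric_space M e"
    unfolding M_def e_def by unfold_locales (auto simp: gf X.commute X.triangle)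
  define Y where "Y = metric (M, e)"
  have Y: "mspace Y = M" "mdist Y = e"
    unfolding Y_def using M by (simp_all add: Metric_space.mspace_metric Metric_space.mdist_metric)
  have "continuous_map (mtopology_of X) (mtopology_of Y) f"
    by (rule uniformly_continuous_imp_continuous_map[OF Lipschitz_imp_uniformly_continuous_map])
       (auto simp: Lipschitz_continuous_map_def Y M_def e_def gf intro!: exI[of _ 1])
  then have "compactin (mtopology_of Y) (f ` mspace X)"
    using cX image_compactin by (fastforce simp: compact_space_def)
  then have cY: "compact_space (mtopology_of Y)"
    by (simp add: compact_space_def Y M_def)
  have "labeled_metric_space L (Y, f \<circ> \<alpha>)"
    using cY \<alpha> by (auto simp: labeled_metric_space_def Y M_def)
  moreover have "L_isometric L P (Y, f \<circ> \<alpha>)"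
    unfolding P L_isometric_def prod.case
    by (rule exI[of _ f]) (auto simp: bij_betw_def f Y M_def e_def gf)
  ultimately show ?thesis by blast
qed

lemma LGH_class_nonempty:
  assumes "labeled_metric_space L P"
  shows "LGH_class L P \<noteq> {}"
  using L_isometric_universe[OF assms] by (auto simp: LGH_class_def)

lemma LGH_class_in_LGH_space:
  assumes "labeled_metric_space L P"
  shows "LGH_class L P \<in> LGH_space L"
proof -
  obtain Q :: "'a universal_space" where Q: "labeled_metric_space L Q" "L_isometric L P Q"
    using L_isometric_universe[OF assms] by blast
  have "LGH_class L P = {(P, Q). labeled_metric_space L P \<and> labeled_metric_space L Q \<and>
      L_isometric L P Q} `` {Q}"
  proof -
    have "L_isometric L Q P" by (rule L_isometric_sym[OF assms Q(2)])
    then have "L_isometric L P R \<longleftrightarrow> L_isometric L Q R" for R :: "'a universal_space"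
      using L_isometric_trans[OF assms Q(2), of R] L_isometric_trans[OF Q(1), of P R] by blast
    then show ?thesis
      unfolding LGH_class_def using Q(1) by auto
  qed
  then show ?thesis
    unfolding LGH_space_def using Q(1) by (simp only: quotientI mem_Collect_eq)
qed

lemma LGH_class_eq_iff:
  assumes "labeled_metric_space L P" and "labeled_metric_space L Q"
  shows "LGH_class L P = LGH_class L Q \<longleftrightarrow> L_isometric L P Q"
proof
  assume "LGH_class L P = LGH_class L Q"
  moreover obtain R :: "'a universal_space" where "R \<in> LGH_class L P"
    using LGH_class_nonempty[OF assms(1)] by blast
  ultimately have "L_isometric L P R" and "L_isometric L Q R"
    by (auto simp: LGH_class_def)
  then show "L_isometric L P Q"
    using L_isometric_trans[OF assms(1) _ L_isometric_sym[OF assms(2)]] by blast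
next
  assume PQ: "L_isometric L P Q"
  have "L_isometric L Q P" by (rule L_isometric_sym[OF assms(1) PQ])
  then have "L_isometric L P R \<longleftrightarrow> L_isometric L Q R" for R :: "'a universal_space"
    using L_isometric_trans[OF assms(1) PQ, of R] L_isometric_trans[OF assms(2), of P R] by blast
  then show "LGH_class L P = LGH_class L Q"
    by (simp add: LGH_class_def)
qed

lemma lgh_admissible_transport:
  assumes P: "labeled_metric_space L P" and Q: "labeled_metric_space L Q"
    and P': "L_isometric L P' P" and Q': "L_isometric L Q' Q"
    and d: "lgh_admissible t L P Q d"
  shows "\<exists>d'. lgh_admissible t L P' Q' d'"
proof -
  obtain X \<alpha> Y \<beta> X' \<alpha>' Y' \<beta>' where eqs: "P = (X, \<alpha>)" "Q = (Y, \<beta>)" "P' = (X', \<alpha>')" "Q' = (Y', \<beta>')"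
    by (cases P, cases Q, cases P', cases Q') auto
  obtain h where h: "h ` mspace X' = mspace X"
      "\<And>x y. x \<in> mspace X' \<Longrightarrow> y \<in> mspace X' \<Longrightarrow> mdist X (h x) (h y) = mdist X' x y"
      "\<And>l. l \<in> L \<Longrightarrow> h (\<alpha>' l) = \<alpha> l"
    using P' unfolding eqs L_isometric_def by (auto simp: bij_betw_def)
  obtain k where k: "k ` mspace Y' = mspace Y"
      "\<And>x y. x \<in> mspace Y' \<Longrightarrow> y \<in> mspace Y' \<Longrightarrow> mdist Y (k x) (k y) = mdist Y' x y"
      "\<And>l. l \<in> L \<Longrightarrow> k (\<beta>' l) = \<beta> l"
    using Q' unfolding eqs L_isometric_def by (auto simp: bij_betw_def)
  define m where "m = map_sum h k"
  define d' where "d' = (\<lambda>u v. d (m u) (m v))"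
  have m: "m u \<in> mspace X <+> mspace Y" if "u \<in> mspace X' <+> mspace Y'" for u
    using that h(1) k(1) by (auto simp: m_def)
  have hm: "\<And>x. x \<in> mspace X' \<Longrightarrow> h x \<in> mspace X" and km: "\<And>x. x \<in> mspace Y' \<Longrightarrow> k x \<in> mspace Y"
    using h(1) k(1) by auto
  have "pseudometric_on (mspace X' <+> mspace Y') d'"
    using d m unfolding eqs lgh_admissible_def pseudometric_on_def d'_def prod.case by blast
  moreover have "hausdorff_dist d' (Inl ` mspace X') (Inr ` mspace Y') =
      hausdorff_dist d (Inl ` mspace X) (Inr ` mspace Y)"
    unfolding hausdorff_dist_def h(1)[symmetric] k(1)[symmetric]
    by (simp add: image_image d'_def m_def)
  moreover have "(SUP l\<in>L. ennreal (d' (Inl (\<alpha>' l)) (Inr (\<beta>' l)))) =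
      (SUP l\<in>L. ennreal (d (Inl (\<alpha> l)) (Inr (\<beta> l))))"
    by (rule SUP_cong) (auto simp: d'_def m_def h k)
  ultimately have "lgh_admissible t L P' Q' d'"
    using d h(2) k(2) hm km unfolding eqs lgh_admissible_def by (auto simp: d'_def m_def)
  then show ?thesis by blast
qed

lemma lgh_dist_cong:
  assumes "labeled_metric_space L P" "labeled_metric_space L P'" "L_isometric L P P'"
    and "labeled_metric_space L Q" "labeled_metric_space L Q'" "L_isometric L Q Q'"
  shows "lgh_dist L P Q = lgh_dist L P' Q'"
proof -
  have "(\<exists>d. lgh_admissible t L P Q d) \<longleftrightarrow> (\<exists>d. lgh_admissible t L P' Q' d)" for t
    using lgh_admissible_transport[OF assms(1,4) L_isometric_sym[OF assms(1,3)]
        L_isometric_sym[OF assms(4,6)]]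
      lgh_admissible_transport[OF assms(2,5,3,6)] by metis
  then show ?thesis unfolding lgh_dist_def by simp
qed

lemma LGH_space_dist_class:
  assumes "labeled_metric_space L P" and "labeled_metric_space L Q"
  shows "LGH_space_dist L (LGH_class L P) (LGH_class L Q) = lgh_dist L P Q"
proof -
  define P' where "P' = (SOME R. R \<in> LGH_class L P)"
  define Q' where "Q' = (SOME R. R \<in> LGH_class L Q)"
  have "P' \<in> LGH_class L P"
    unfolding P'_def using LGH_class_nonempty[OF assms(1)] by (auto intro: someI)
  then have P': "labeled_metric_space L P'" "L_isometric L P P'" by (auto simp: LGH_class_def)
  have "Q' \<in> LGH_class L Q"
    unfolding Q'_def using LGH_class_nonempty[OF assms(2)] by (auto intro: someI)
  then have Q': "labeled_metric_space L Q'" "L_isometric L Q Q'" by (auto simp: LGH_class_def)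
  show ?thesis
    unfolding LGH_space_dist_def P'_def[symmetric] Q'_def[symmetric]
    by (rule lgh_dist_cong[OF assms(1) P' assms(2) Q', symmetric])
qed

end

theory Submission
  imports Defs "HOL-Complex_Analysis.Great_Picard"
begin

text \<open>
  Enumerate the points of the finite nets of each space \<open>X\<^sub>n\<close> uniformly in \<open>n\<close> and adjoin the
  labels: this gives maps \<open>q\<^sub>n\<close> into \<open>X\<^sub>n\<close> from one index set \<open>I = \<nat> \<squnion> L\<close>. By compactness of \<open>L\<close>
  and equicontinuity a countable subset of \<open>I\<close> is dense for all the pseudometrics
  \<open>d\<^sub>n(i, j) = d(q\<^sub>n i, q\<^sub>n j)\<close> simultaneously, so a diagonal subsequence of \<open>d\<^sub>n\<close> converges pointwise
  on \<open>I \<times> I\<close>. The limit pseudometric is totally bounded; the closure of its Kuratowski embedding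
  is the compact limit space, labeled by the images of the points of \<open>L\<close>. Closeness in the
  labeled Gromov--Hausdorff distance follows by gluing along finitely many indices.
\<close>

section \<open>Compact realization of totally bounded pseudometrics\<close>

text \<open>Two triangle inequalities in each direction. This Lipschitz estimate makes the
  Kuratowski coordinates bounded and carries convergence from a dense set of indices to all of
  them.\<close>

lemma pseudometric_on_diff_le:
  assumes "pseudometric_on I \<rho>" "i \<in> I" "i' \<in> I" "j \<in> I" "j' \<in> I"
  shows "\<bar>\<rho> i j - \<rho> i' j'\<bar> \<le> \<rho> i i' + \<rho> j j'"
proof -
  have "\<rho> i j \<le> \<rho> i i' + \<rho> i' j" "\<rho> i' j \<le> \<rho> i' j' + \<rho> j' j"
    "\<rho> i' j' \<le> \<rho> i' i + \<rho> i j'" "\<rho> i j' \<le> \<rho> i j + \<rho> j j'"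
    "\<rho> i' i = \<rho> i i'" "\<rho> j' j = \<rho> j j'"
    using assms unfolding pseudometric_on_def by metis+
  then show ?thesis by linarith
qed

text \<open>Cauchy in the sup metric means uniformly Cauchy, and a uniform limit of bounded
  continuous functions is again one. Completeness turns total boundedness of a closed set into
  compactness below.\<close>

lemma complete_UNIV_bcontfun:
  "complete (UNIV :: ('a::topological_space \<Rightarrow>\<^sub>C 'b::complete_space) set)"
  unfolding complete_def
proof (intro allI impI)
  fix f :: "nat \<Rightarrow> 'a \<Rightarrow>\<^sub>C 'b" assume f: "(\<forall>n. f n \<in> UNIV) \<and> Cauchy f"
  have "uniformly_Cauchy_on UNIV (\<lambda>n. apply_bcontfun (f n))"
  proof (rule uniformly_Cauchy_onI)
    fix e :: real assume "e > 0"
    with f obtain M where "\<forall>m\<ge>M. \<forall>n\<ge>M. dist (f m) (f n) < e" unfolding Cauchy_def by blast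
    then show "\<exists>M. \<forall>x\<in>UNIV. \<forall>m\<ge>M. \<forall>n\<ge>M. dist (f m x) (f n x) < e"
      using dist_fun_lt_imp_dist_val_lt by blast
  qed
  then obtain g where "uniform_limit UNIV (\<lambda>n. apply_bcontfun (f n)) g sequentially"
    using Cauchy_uniformly_convergent unfolding uniformly_convergent_on_def by blast
  then obtain g' where "f \<longlonglongrightarrow> g'"
    using uniform_limit_bcontfunE sequentially_bot by metis
  then show "\<exists>l\<in>UNIV. f \<longlonglongrightarrow> l" by blast
qed

text \<open>Kuratowski embedding along a dense sequence of indices. Indices at
  \<open>\<rho>\<close>-distance 0 receive the same image, so no quotient has to be formed. Density
  of the image in \<open>K\<close> lets nets of indices become nets of \<open>K\<close>.\<close>

lemma totally_bounded_pseudometric_embedding: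
  assumes \<rho>: "pseudometric_on I \<rho>"
    and tb: "\<And>e. e > 0 \<Longrightarrow> \<exists>F. finite F \<and> F \<subseteq> I \<and> (\<forall>i\<in>I. \<exists>j\<in>F. \<rho> i j < e)"
  obtains K and b :: "'i \<Rightarrow> nat \<Rightarrow>\<^sub>C real" where
    "compact K" "b ` I \<subseteq> K" "K \<subseteq> closure (b ` I)"
    "\<And>i j. i \<in> I \<Longrightarrow> j \<in> I \<Longrightarrow> dist (b i) (b j) = \<rho> i j"
proof (cases "I = {}")
  case True
  then show ?thesis using that[of "{}"] by simp
next
  case False
  have "\<exists>F. finite F \<and> F \<subseteq> I \<and> (\<forall>i\<in>I. \<exists>j\<in>F. \<rho> i j < 1 / Suc n)" for n :: nat
    by (rule tb) simp
  then obtain F where F: "\<And>n::nat. finite (F n)" "\<And>n. F n \<subseteq> I"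
    "\<And>n i. i \<in> I \<Longrightarrow> \<exists>j\<in>F n. \<rho> i j < 1 / Suc n"
    by metis
  define A where "A = (\<Union>n. F n)"
  have A: "countable A" "A \<subseteq> I" "A \<noteq> {}"
    using F False unfolding A_def
    by (auto intro!: countable_UN intro: countable_finite)
  define a where "a = from_nat_into A"
  have ra: "range a = A"
    unfolding a_def using A by (intro range_from_nat_into)
  then have aI: "a m \<in> I" for m using A by auto
  have dense: "\<exists>m. \<rho> i (a m) < e" if "i \<in> I" "e > 0" for i e
  proof -
    obtain n :: nat where "1 / Suc n < e" using nat_approx_posE[OF \<open>e > 0\<close>] by blast
    moreover obtain j where "j \<in> F n" "\<rho> i j < 1 / Suc n" using F(3)[OF \<open>i \<in> I\<close>] by blast
    moreover have "j \<in> range a" using \<open>j \<in> F n\<close> by (auto simp: ra A_def)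
    then obtain m where "a m = j" by blast
    ultimately show ?thesis using less_trans by blast
  qed
  have refl: "\<rho> i i = 0" if "i \<in> I" for i
    using \<rho> that unfolding pseudometric_on_def by blast
  have sym: "\<rho> i j = \<rho> j i" if "i \<in> I" "j \<in> I" for i j
    using \<rho> that unfolding pseudometric_on_def by blast
  have diff: "\<bar>\<rho> i (a m) - \<rho> j (a m)\<bar> \<le> \<rho> i j" if "i \<in> I" "j \<in> I" for i j m
    using pseudometric_on_diff_le[OF \<rho> that aI[of m] aI[of m]] refl[OF aI[of m]] by simp
  \<comment> \<open>Subtracting the coordinates of the base index \<open>a 0\<close> keeps each
    sequence bounded, by \<open>\<rho> i (a 0)\<close>. As \<open>nat\<close> is discrete, every
    bounded sequence is a bounded continuous function.\<close>
  define b where "b = (\<lambda>i. Bcontfun (\<lambda>m. \<rho> i (a m) - \<rho> (a 0) (a m)))"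
  have b: "b i m = \<rho> i (a m) - \<rho> (a 0) (a m)" if "i \<in> I" for i m
  proof -
    have "bounded (range (\<lambda>m. \<rho> i (a m) - \<rho> (a 0) (a m)))"
      using diff[OF that aI[of 0]] by (auto simp: bounded_iff)
    then have "(\<lambda>m. \<rho> i (a m) - \<rho> (a 0) (a m)) \<in> bcontfun"
      by (simp add: bcontfun_def)
    then show ?thesis unfolding b_def by (simp add: Bcontfun_inverse)
  qed
  have dist: "dist (b i) (b j) = \<rho> i j" if ij: "i \<in> I" "j \<in> I" for i j
  proof (rule antisym)
    show "dist (b i) (b j) \<le> \<rho> i j"
      by (rule dist_bound) (use diff[OF ij] in \<open>simp add: b ij dist_real_def\<close>)
    show "\<rho> i j \<le> dist (b i) (b j)"
    proof (rule field_le_epsilon)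
      fix e :: real assume "e > 0"
      \<comment> \<open>The coordinate of an index \<open>a m\<close> close to \<open>j\<close>
        almost attains the supremum: the loss is at most \<open>2 * \<rho> j (a m)\<close>, hence
        \<open>e / 2\<close>.\<close>
      then obtain m where m: "\<rho> j (a m) < e / 2" using dense[OF ij(2), of "e/2"] by auto
      have "\<rho> i j \<le> \<rho> i (a m) + \<rho> j (a m)"
        using \<rho> ij aI[of m] unfolding pseudometric_on_def by metis
      moreover have "\<rho> i (a m) - \<rho> j (a m) \<le> dist (b i) (b j)"
        using dist_bounded[of "b i" m "b j"] by (simp add: b ij dist_real_def)
      ultimately show "\<rho> i j \<le> dist (b i) (b j) + e" using m by linarith
    qed
  qed
  define K where "K = closure (b ` I)"
  have "\<exists>k. finite k \<and> K \<subseteq> (\<Union>x\<in>k. ball x e)" if e: "e > 0" for e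
  proof -
    obtain F where F: "finite F" "F \<subseteq> I" "\<And>i. i \<in> I \<Longrightarrow> \<exists>j\<in>F. \<rho> i j < e / 2"
      using tb[of "e/2"] e by auto
    \<comment> \<open>An \<open>e / 2\<close>-net of the image is an \<open>e\<close>-net of its
      closure: one half is spent on approximating \<open>y\<close>, the other on the net.\<close>
    have "K \<subseteq> (\<Union>x\<in>b ` F. ball x e)"
    proof
      fix y assume "y \<in> K"
      then obtain i where i: "i \<in> I" "dist (b i) y < e / 2"
        using e unfolding K_def closure_approachable
        by (metis half_gt_zero imageE)
      obtain j where j: "j \<in> F" "\<rho> i j < e / 2" using F(3)[OF i(1)] by blast
      have "dist (b i) (b j) < e / 2" using dist i(1) j F(2) by auto
      then have "dist (b j) y < e"
        using i(2) dist_triangle_half_r[of "b i" "b j" e y] by (simp add: dist_commute)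
      then show "y \<in> (\<Union>x\<in>b ` F. ball x e)" using j by auto
    qed
    then show ?thesis using F(1) by blast
  qed
  moreover have "complete K" 
    unfolding K_def using complete_UNIV_bcontfun by (rule complete_closed_subset[rotated 2]) auto
  ultimately have "compact K" by (simp add: compact_eq_totally_bounded)
  with dist show ?thesis
    by (intro that[of K b]) (auto simp: K_def closure_subset)
qed

section \<open>Upper bounds for the distance by gluing along finitely many points\<close>

lemma hausdorff_dist_le:
  assumes "\<And>a. a \<in> A \<Longrightarrow> \<exists>b\<in>B. d a b \<le> t" and "\<And>b. b \<in> B \<Longrightarrow> \<exists>a\<in>A. d a b \<le> t"
  shows "hausdorff_dist d A B \<le> ennreal t"
  unfolding hausdorff_dist_def
proof (intro max.boundedI SUP_least)
  fix a assume "a \<in> A"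
  then obtain b where "b \<in> B" "d a b \<le> t" using assms(1) by blast
  then show "(INF b\<in>B. ennreal (d a b)) \<le> ennreal t" by (intro INF_lower2[of b] ennreal_leI)
next
  fix b assume "b \<in> B"
  then obtain a where "a \<in> A" "d a b \<le> t" using assms(2) by blast
  then show "(INF a\<in>A. ennreal (d a b)) \<le> ennreal t" by (intro INF_lower2[of a] ennreal_leI)
qed

text \<open>Join each \<open>a i\<close> to \<open>b i\<close> by a bridge of length
  \<open>t\<close> and measure across by the cheapest path over one bridge. The bound
  \<open>3 * t\<close> is the worst case, that of labels: \<open>t\<close> to reach the bridge,
  \<open>t\<close> to cross it, \<open>t\<close> to leave it.\<close>

lemma lgh_dist_le_of_correspondence:
  fixes X :: "'a metric" and Y :: "'b metric" and a :: "'i \<Rightarrow> 'a" and b :: "'i \<Rightarrow> 'b"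
  assumes J: "finite J" "J \<noteq> {}" and aX: "a ` J \<subseteq> mspace X" and bY: "b ` J \<subseteq> mspace Y"
    and t: "0 \<le> t"
    and dis: "\<And>i j. i \<in> J \<Longrightarrow> j \<in> J \<Longrightarrow> \<bar>mdist X (a i) (a j) - mdist Y (b i) (b j)\<bar> \<le> t"
    and netX: "\<And>x. x \<in> mspace X \<Longrightarrow> \<exists>i\<in>J. mdist X x (a i) \<le> t"
    and netY: "\<And>y. y \<in> mspace Y \<Longrightarrow> \<exists>i\<in>J. mdist Y y (b i) \<le> t"
    and lab: "\<And>l. l \<in> L \<Longrightarrow> \<alpha> l \<in> mspace X \<and> \<beta> l \<in> mspace Y \<and>
                (\<exists>i\<in>J. mdist X (\<alpha> l) (a i) \<le> t \<and> mdist Y (\<beta> l) (b i) \<le> t)"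
  shows "lgh_dist L (X, \<alpha>) (Y, \<beta>) \<le> ennreal (3 * t)"
proof -
  \<comment> \<open>\<open>c x y i\<close> is the length of the path from \<open>x\<close> to
    \<open>y\<close> over bridge \<open>i\<close>. The minimum \<open>e\<close> is attained because
    \<open>J\<close> is finite and nonempty.\<close>
  define c where "c = (\<lambda>x y i. mdist X x (a i) + t + mdist Y y (b i))"
  define e where "e = (\<lambda>x y. Min (c x y ` J))"
  define d where "d = (\<lambda>u v. case u of
      Inl x \<Rightarrow> (case v of Inl x' \<Rightarrow> mdist X x x' | Inr y \<Rightarrow> e x y)
    | Inr y \<Rightarrow> (case v of Inl x \<Rightarrow> e x y | Inr y' \<Rightarrow> mdist Y y y'))"
  have e_le: "e x y \<le> c x y i" if "i \<in> J" for x y i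
    unfolding e_def using J that by simp
  have e_attained: "\<exists>i\<in>J. e x y = c x y i" for x y
  proof -
    have "Min (c x y ` J) \<in> c x y ` J" using J by (intro Min_in) auto
    then show ?thesis unfolding e_def by blast
  qed
  have a: "a i \<in> mspace X" and b: "b i \<in> mspace Y" if "i \<in> J" for i
    using that aX bY by auto
  have nonneg: "0 \<le> e x y" for x y
    using e_attained[of x y] t by (auto simp: c_def)
  have tX: "mdist X x z \<le> mdist X x y + mdist X y z"
    if "x \<in> mspace X" "y \<in> mspace X" "z \<in> mspace X" for x y z
    using that by (rule mdist_triangle)
  have tY: "mdist Y x z \<le> mdist Y x y + mdist Y y z"
    if "x \<in> mspace Y" "y \<in> mspace Y" "z \<in> mspace Y" for x y z
    using that by (rule mdist_triangle)
  have XXY: "e x y \<le> mdist X x x' + e x' y"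
    if "x \<in> mspace X" "x' \<in> mspace X" for x x' y
  proof -
    obtain i where "i \<in> J" "e x' y = c x' y i" using e_attained by blast
    then show ?thesis using e_le[of i x y] tX[OF that a[of i]] unfolding c_def by linarith
  qed
  have XYY: "e x y' \<le> e x y + mdist Y y y'"
    if "y \<in> mspace Y" "y' \<in> mspace Y" for x y y'
  proof -
    obtain i where "i \<in> J" "e x y = c x y i" using e_attained by blast
    then show ?thesis
      using e_le[of i x y'] tY[OF that(2,1) b[of i]] mdist_commute[of Y y y']
      unfolding c_def by linarith
  qed
  have XXY': "e x y \<le> e x' y + mdist X x' x"
    if "x \<in> mspace X" "x' \<in> mspace X" for x x' y
    using XXY[OF that, of y] mdist_commute[of X x x'] by linarith
  have XYY': "e x y' \<le> mdist Y y' y + e x y"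
    if "y \<in> mspace Y" "y' \<in> mspace Y" for x y y'
    using XYY[OF that, of x] mdist_commute[of Y y y'] by linarith
  \<comment> \<open>A detour through \<open>Y\<close> crosses two bridges \<open>i\<close> and
    \<open>j\<close>. Their lengths sum to \<open>2 * t\<close>, which pays for the distortion, at
    most \<open>t\<close>, in replacing the distance of \<open>b i\<close> and \<open>b j\<close> by
    that of \<open>a i\<close> and \<open>a j\<close>.\<close>
  have XYX: "mdist X x x' \<le> e x y + e x' y"
    if "x \<in> mspace X" "x' \<in> mspace X" "y \<in> mspace Y" for x x' y
  proof -
    obtain i where i: "i \<in> J" "e x y = c x y i" using e_attained by blast
    obtain j where j: "j \<in> J" "e x' y = c x' y j" using e_attained by blast
    show ?thesis
      using tX[OF that(1) a[OF i(1)] that(2)] tX[OF a[OF i(1)] a[OF j(1)] that(2)]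
        tY[OF b[OF i(1)] that(3) b[OF j(1)]] dis[OF i(1) j(1)] t i(2) j(2)
        mdist_commute[of X x' "a j"] mdist_commute[of Y y "b i"]
      unfolding c_def by linarith
  qed
  have YXY: "mdist Y y y' \<le> e x y + e x y'"
    if "x \<in> mspace X" "y \<in> mspace Y" "y' \<in> mspace Y" for x y y'
  proof -
    obtain i where i: "i \<in> J" "e x y = c x y i" using e_attained by blast
    obtain j where j: "j \<in> J" "e x y' = c x y' j" using e_attained by blast
    show ?thesis
      using tY[OF that(2) b[OF i(1)] that(3)] tY[OF b[OF i(1)] b[OF j(1)] that(3)]
        tX[OF a[OF i(1)] that(1) a[OF j(1)]] dis[OF i(1) j(1)] t i(2) j(2)
        mdist_commute[of Y y' "b j"] mdist_commute[of X x "a i"]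
      unfolding c_def by linarith
  qed
  \<comment> \<open>Eight cases by the sides of the three points: two lie within one space, the
    other six are the inequalities just shown.\<close>
  have tri: "d u w \<le> d u v + d v w"
    if "u \<in> mspace X <+> mspace Y" "v \<in> mspace X <+> mspace Y" "w \<in> mspace X <+> mspace Y"
    for u v w
    using that XXY XYY XXY' XYY' XYX YXY
    by (elim PlusE) (simp_all add: d_def tX tY add.commute)
  have ps: "pseudometric_on (mspace X <+> mspace Y) d"
    unfolding pseudometric_on_def
  proof (intro conjI ballI)
    show "0 \<le> d u v" for u v by (auto simp: d_def nonneg split: sum.split)
    show "d u u = 0" if "u \<in> mspace X <+> mspace Y" for u using that by (auto simp: d_def)
    show "d u v = d v u" for u v by (auto simp: d_def mdist_commute split: sum.split)
  qed (rule tri)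
  have "hausdorff_dist d (Inl ` mspace X) (Inr ` mspace Y) \<le> ennreal (3 * t)"
  proof (rule hausdorff_dist_le)
    fix u :: "'a + 'b" assume "u \<in> Inl ` mspace X"
    then obtain x where x: "u = Inl x" "x \<in> mspace X" by auto
    obtain i where i: "i \<in> J" "mdist X x (a i) \<le> t" using netX x by blast
    \<comment> \<open>The partner of \<open>x\<close> is the far end of the bridge itself, so the
      third leg of the path has length 0.\<close>
    have "mdist Y (b i) (b i) = 0" using b[OF i(1)] by simp
    then have "e x (b i) \<le> 3 * t"
      using e_le[OF i(1), of x "b i"] i(2) t unfolding c_def by linarith
    then have "d u (Inr (b i)) \<le> 3 * t" by (simp add: d_def x)
    then show "\<exists>v\<in>Inr ` mspace Y. d u v \<le> 3 * t" using b[OF i(1)] by blast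
  next
    fix v :: "'a + 'b" assume "v \<in> Inr ` mspace Y"
    then obtain y where y: "v = Inr y" "y \<in> mspace Y" by auto
    obtain i where i: "i \<in> J" "mdist Y y (b i) \<le> t" using netY y by blast
    have "mdist X (a i) (a i) = 0" using a[OF i(1)] by simp
    then have "e (a i) y \<le> 3 * t"
      using e_le[OF i(1), of "a i" y] i(2) t unfolding c_def by linarith
    then have "d (Inl (a i)) v \<le> 3 * t" by (simp add: d_def y)
    then show "\<exists>u\<in>Inl ` mspace X. d u v \<le> 3 * t" using a[OF i(1)] by blast
  qed
  moreover have "(SUP l\<in>L. ennreal (d (Inl (\<alpha> l)) (Inr (\<beta> l)))) \<le> ennreal (3 * t)"
  proof (intro SUP_least ennreal_leI)
    fix l assume "l \<in> L"
    then obtain i where i: "i \<in> J" "mdist X (\<alpha> l) (a i) \<le> t" "mdist Y (\<beta> l) (b i) \<le> t"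
      using lab by blast
    then show "d (Inl (\<alpha> l)) (Inr (\<beta> l)) \<le> 3 * t"
      using e_le[OF i(1), of "\<alpha> l" "\<beta> l"] by (simp add: d_def c_def)
  qed
  ultimately have "lgh_admissible (3 * t) L (X, \<alpha>) (Y, \<beta>) d"
    using ps unfolding lgh_admissible_def by (simp add: d_def)
  then show ?thesis
    unfolding lgh_dist_def using t by (intro Inf_lower) auto
qed

section \<open>Limits of pseudometrics on a common index set\<close>

text \<open>An Arzela-Ascoli argument: a diagonal subsequence converges on the countable set
  \<open>C \<times> C\<close>. Since \<open>dense\<close> provides a \<open>c\<close> that serves
  all \<open>n\<close> at once, the sequences at the other pairs are Cauchy too.\<close>

lemma convergent_subsequence_of_pseudometrics:
  fixes d :: "nat \<Rightarrow> 'i \<Rightarrow> 'i \<Rightarrow> real"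
  assumes d: "\<And>n. pseudometric_on I (d n)"
    and bd: "\<And>n i j. i \<in> I \<Longrightarrow> j \<in> I \<Longrightarrow> d n i j \<le> D"
    and C: "countable C" "C \<subseteq> I"
    and dense: "\<And>i e. i \<in> I \<Longrightarrow> e > 0 \<Longrightarrow> \<exists>c\<in>C. \<forall>n. d n i c < e"
  obtains r where "strict_mono r" "\<And>i j. i \<in> I \<Longrightarrow> j \<in> I \<Longrightarrow> convergent (\<lambda>n. d (r n) i j)"
proof -
  have "norm (case p of (i, j) \<Rightarrow> d n i j) \<le> D" if "p \<in> C \<times> C" for n p
  proof -
    obtain i j where p: "p = (i, j)" "i \<in> I" "j \<in> I" using \<open>p \<in> C \<times> C\<close> C(2) by auto
    then have "0 \<le> d n i j" using d[of n] unfolding pseudometric_on_def by blast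
    then show ?thesis using bd p by simp
  qed
  moreover have "countable (C \<times> C)" using C(1) by simp
  ultimately obtain r where r: "strict_mono (r :: nat \<Rightarrow> nat)"
    "\<And>p. p \<in> C \<times> C \<Longrightarrow> \<exists>l. (\<lambda>n. case p of (i, j) \<Rightarrow> d (r n) i j) \<longlonglongrightarrow> l"
    using function_convergent_subsequence[of "C \<times> C" "\<lambda>n p. case p of (i, j) \<Rightarrow> d n i j" D]
    by blast
  show ?thesis
  proof (rule that[OF r(1)])
    fix i j assume ij: "i \<in> I" "j \<in> I"
    have "Cauchy (\<lambda>n. d (r n) i j)"
    proof (rule metric_CauchyI)
      fix e :: real assume "e > 0"
      \<comment> \<open>Replacing \<open>i, j\<close> by \<open>c, c'\<close> costs
        \<open>2 * e / 5\<close> at each of the times \<open>m\<close> and \<open>n\<close>; the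
        Cauchy property at \<open>c, c'\<close> uses the fifth share.\<close>
      then have e: "e / 5 > 0" by simp
      obtain c where c: "c \<in> C" "\<And>n. d n i c < e / 5" using dense[OF ij(1) e] by blast
      obtain c' where c': "c' \<in> C" "\<And>n. d n j c' < e / 5" using dense[OF ij(2) e] by blast
      have "Cauchy (\<lambda>n. d (r n) c c')"
        using r(2)[of "(c, c')"] c(1) c'(1) by (simp add: Cauchy_convergent_iff convergent_def)
      then obtain M where M: "\<And>m n. m \<ge> M \<Longrightarrow> n \<ge> M \<Longrightarrow>
          \<bar>d (r m) c c' - d (r n) c c'\<bar> < e / 5"
        using e unfolding Cauchy_def dist_real_def by blast
      have near: "\<bar>d n i j - d n c c'\<bar> < 2 * e / 5" for n
        using pseudometric_on_diff_le[OF d[of n] ij(1) _ ij(2), of c c'] c(1) c'(1) C(2)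
          c(2)[of n] c'(2)[of n] by fastforce
      have "dist (d (r m) i j) (d (r n) i j) < e" if "m \<ge> M" "n \<ge> M" for m n
        using M[OF that] near[of "r m"] near[of "r n"] unfolding dist_real_def by linarith
      then show "\<exists>M. \<forall>m\<ge>M. \<forall>n\<ge>M. dist (d (r m) i j) (d (r n) i j) < e" by blast
    qed
    then show "convergent (\<lambda>n. d (r n) i j)" by (rule Cauchy_convergent)
  qed
qed

lemma pseudometric_on_limit:
  assumes d: "\<And>n. pseudometric_on I (d n)"
    and lim: "\<And>i j. i \<in> I \<Longrightarrow> j \<in> I \<Longrightarrow> (\<lambda>n. d n i j) \<longlonglongrightarrow> \<rho> i j"
  shows "pseudometric_on I \<rho>"
  unfolding pseudometric_on_def
proof (intro conjI ballI)
  fix i j assume ij: "i \<in> I" "j \<in> I"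
  show "0 \<le> \<rho> i j"
    by (rule LIMSEQ_le_const[OF lim[OF ij]]) (use d ij in \<open>auto simp: pseudometric_on_def\<close>)
  have "d n i j = d n j i" for n
    using d ij unfolding pseudometric_on_def by blast
  then show "\<rho> i j = \<rho> j i"
    using LIMSEQ_unique[OF lim[OF ij]] lim[OF ij(2,1)] by simp
next
  fix i assume i: "i \<in> I"
  have "d n i i = 0" for n using d i unfolding pseudometric_on_def by blast
  then show "\<rho> i i = 0" using lim[OF i i] by (simp add: LIMSEQ_const_iff)
next
  fix i j k assume ijk: "i \<in> I" "j \<in> I" "k \<in> I"
  have "d n i k \<le> d n i j + d n j k" for n using d ijk unfolding pseudometric_on_def by blast
  then show "\<rho> i k \<le> \<rho> i j + \<rho> j k"
    by (intro LIMSEQ_le[OF lim[OF ijk(1,3)] tendsto_add[OF lim[OF ijk(1,2)] lim[OF ijk(2,3)]]]) auto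
qed

section \<open>Uniform enumeration of nets\<close>

text \<open>The finite set \<open>F\<close> of positions is the same for all \<open>n\<close>. This
  is possible because the net sizes are bounded uniformly, and it makes points of different spaces
  comparable by their positions.\<close>

lemma uniformly_totally_bounded_enumeration:
  fixes X :: "nat \<Rightarrow> 'a metric"
  assumes utb: "uniformly_totally_bounded \<C>" and X: "range X \<subseteq> \<C>"
    and ne: "\<And>n. mspace (X n) \<noteq> {}"
  obtains p :: "nat \<Rightarrow> nat \<Rightarrow> 'a" where "\<And>n k. p n k \<in> mspace (X n)"
    "\<And>e. e > 0 \<Longrightarrow> \<exists>F. finite F \<and> (\<forall>n. \<forall>x\<in>mspace (X n). \<exists>k\<in>F. mdist (X n) x (p n k) < e)"
proof -
  have nets: "\<exists>N::nat. \<forall>n. \<exists>f. f ` {..<N} \<subseteq> mspace (X n) \<and>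
          (\<forall>x\<in>mspace (X n). \<exists>i<N. mdist (X n) x (f i) < e)" if "e > 0" for e
  proof -
    obtain N where N: "\<And>n. \<exists>S. eps_net (X n) e S \<and> finite S \<and> card S \<le> N"
      using utb X \<open>e > 0\<close> unfolding uniformly_totally_bounded_def by (metis range_subsetD)
    have "\<exists>f. f ` {..<N} \<subseteq> mspace (X n) \<and>
            (\<forall>x\<in>mspace (X n). \<exists>i<N. mdist (X n) x (f i) < e)" for n
    proof -
      obtain S where S: "eps_net (X n) e S" "finite S" "card S \<le> N" using N by blast
      obtain s where s: "s \<in> S" using S(1) ne[of n] unfolding eps_net_def by blast
      obtain h where h: "bij_betw h {0..<card S} S"
        using ex_bij_betw_nat_finite[OF S(2)] by blast
      \<comment> \<open>Nets with fewer than \<open>N\<close> points are padded by repeating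
        \<open>s\<close>, so that all lists have the common length \<open>N\<close>.\<close>
      define f where "f = (\<lambda>i. if i < card S then h i else s)"
      have f_S: "f ` {..<N} \<subseteq> S" using s bij_betwE[OF h] by (auto simp: f_def)
      have S_f: "\<exists>i<N. f i = y" if "y \<in> S" for y
      proof -
        have "y \<in> h ` {0..<card S}" using that bij_betw_imp_surj_on[OF h] by simp
        then obtain i where "i < card S" "h i = y" by auto
        then show ?thesis using S(3) by (intro exI[of _ i]) (simp add: f_def)
      qed
      have S_X: "S \<subseteq> mspace (X n)" and S_net: "\<And>x. x \<in> mspace (X n) \<Longrightarrow> \<exists>y\<in>S. mdist (X n) x y < e"
        using S(1) unfolding eps_net_def by auto
      have "f ` {..<N} \<subseteq> mspace (X n)"
        "\<And>x. x \<in> mspace (X n) \<Longrightarrow> \<exists>i<N. mdist (X n) x (f i) < e"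
      proof -
        show "f ` {..<N} \<subseteq> mspace (X n)" using f_S S_X by (rule subset_trans)
        fix x assume "x \<in> mspace (X n)"
        then obtain y where "y \<in> S" "mdist (X n) x y < e" using S_net by blast
        then show "\<exists>i<N. mdist (X n) x (f i) < e" using S_f by metis
      qed
      then show ?thesis by blast
    qed
    then show ?thesis by blast
  qed
  \<comment> \<open>Choice is made in this order so that the length \<open>N\<close> depends on the
    precision \<open>k\<close> alone; only the lists depend on \<open>n\<close>.\<close>
  have "\<forall>k::nat. \<exists>N::nat. \<forall>n. \<exists>f. f ` {..<N} \<subseteq> mspace (X n) \<and>
          (\<forall>x\<in>mspace (X n). \<exists>i<N. mdist (X n) x (f i) < 1 / Suc k)"
    by (intro allI nets) simp
  then obtain N :: "nat \<Rightarrow> nat" where "\<forall>k n. \<exists>f. f ` {..<N k} \<subseteq> mspace (X n) \<and>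
          (\<forall>x\<in>mspace (X n). \<exists>i<N k. mdist (X n) x (f i) < 1 / Suc k)"
    by (rule choice[THEN exE]) (rule that)
  then have "\<forall>k. \<exists>f. \<forall>n. f n ` {..<N k} \<subseteq> mspace (X n) \<and>
          (\<forall>x\<in>mspace (X n). \<exists>i<N k. mdist (X n) x (f n i) < 1 / Suc k)"
    by (intro allI choice) blast
  then obtain f where "\<forall>k n. f k n ` {..<N k} \<subseteq> mspace (X n) \<and>
          (\<forall>x\<in>mspace (X n). \<exists>i<N k. mdist (X n) x (f k n i) < 1 / Suc k)"
    by (rule choice[THEN exE]) (rule that)
  then have f: "\<And>n k. f k n ` {..<N k} \<subseteq> mspace (X n)"
    "\<And>n k x. x \<in> mspace (X n) \<Longrightarrow> \<exists>i<N k. mdist (X n) x (f k n i) < 1 / Suc k"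
    by blast+
  define z where "z = (\<lambda>n. SOME x. x \<in> mspace (X n))"
  have z: "z n \<in> mspace (X n)" for n using ne by (simp add: z_def some_in_eq)
  \<comment> \<open>The lists for all precisions are merged by the pairing function. Positions
    beyond the length \<open>N k\<close> get the default point \<open>z n\<close>.\<close>
  define p where "p = (\<lambda>n j. case prod_decode j of (k, i) \<Rightarrow> if i < N k then f k n i else z n)"
  show ?thesis
  proof (rule that[of p])
    show "p n k \<in> mspace (X n)" for n k
      using f(1)[of _ n] z[of n] by (auto simp: p_def image_subset_iff split: prod.split)
    fix e :: real assume "e > 0"
    then obtain k :: nat where k: "1 / Suc k < e" using nat_approx_posE by blast
    have "\<exists>j\<in>prod_encode ` ({k} \<times> {..<N k}). mdist (X n) x (p n j) < e"
      if x: "x \<in> mspace (X n)" for n x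
    proof -
      obtain i where i: "i < N k" "mdist (X n) x (f k n i) < 1 / Suc k"
        using f(2)[OF x] by blast
      then show ?thesis
        using k by (intro bexI[of _ "prod_encode (k, i)"]) (auto simp: p_def)
    qed
    then show "\<exists>F. finite F \<and> (\<forall>n. \<forall>x\<in>mspace (X n). \<exists>k\<in>F. mdist (X n) x (p n k) < e)"
      by (intro exI[of _ "prod_encode ` ({k} \<times> {..<N k})"]) auto
  qed
qed

lemma mdist_le_of_mdiam_le:
  assumes "mdiam X \<le> ennreal D" "0 < D" "x \<in> mspace X" "y \<in> mspace X"
  shows "mdist X x y \<le> D"
proof -
  have "ennreal (mdist X x y) \<le> mdiam X"
    unfolding mdiam_def by (rule SUP_upper2[OF assms(3)], rule SUP_upper[OF assms(4)])
  then have "ennreal (mdist X x y) \<le> ennreal D" using assms(1) by (rule order_trans)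
  then show ?thesis using assms(2) by (simp add: ennreal_le_iff)
qed

section \<open>Construction of the limit space\<close>

text \<open>The label set enters only through finite nets of labels that serve all \<open>n\<close>
  at once, so no topology on \<open>L\<close> appears. The limit is built inside the bounded
  sequences; its isometry class is taken later.\<close>

lemma lgh_convergent_subsequence:
  fixes X :: "nat \<Rightarrow> 'a metric" and \<alpha> :: "nat \<Rightarrow> 'l \<Rightarrow> 'a"
  assumes \<alpha>: "\<And>n l. l \<in> L \<Longrightarrow> \<alpha> n l \<in> mspace (X n)"
    and utb: "uniformly_totally_bounded \<C>" and X: "range X \<subseteq> \<C>"
    and ne: "\<And>n. mspace (X n) \<noteq> {}"
    and equi: "\<And>e. e > 0 \<Longrightarrow>
      \<exists>G. finite G \<and> G \<subseteq> L \<and> (\<forall>l\<in>L. \<exists>g\<in>G. \<forall>n. mdist (X n) (\<alpha> n l) (\<alpha> n g) < e)"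
  obtains r and Q :: "('l, nat \<Rightarrow>\<^sub>C real) labeled_space" where
    "strict_mono (r :: nat \<Rightarrow> nat)" "labeled_metric_space L Q"
    "(\<lambda>n. lgh_dist L (X (r n), \<alpha> (r n)) Q) \<longlonglongrightarrow> 0"
proof -
  obtain p :: "nat \<Rightarrow> nat \<Rightarrow> 'a" where p: "\<And>n k. p n k \<in> mspace (X n)"
    "\<And>e. e > 0 \<Longrightarrow> \<exists>F. finite F \<and> (\<forall>n. \<forall>x\<in>mspace (X n). \<exists>k\<in>F. mdist (X n) x (p n k) < e)"
    using uniformly_totally_bounded_enumeration[OF utb X ne] by blast
  define I where "I = (UNIV :: nat set) <+> L"
  define q where "q = (\<lambda>n. case_sum (p n) (\<alpha> n))"
  have q: "q n i \<in> mspace (X n)" if "i \<in> I" for n i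
    using that p(1) \<alpha> by (auto simp: q_def I_def)
  define d where "d = (\<lambda>n i j. mdist (X n) (q n i) (q n j))"
  have d: "pseudometric_on I (d n)" for n
    unfolding pseudometric_on_def d_def
    by (auto simp: q mdist_commute intro: mdist_triangle)
  obtain D where D: "D > 0" "\<And>X. X \<in> \<C> \<Longrightarrow> mdiam X \<le> ennreal D"
    using utb unfolding uniformly_totally_bounded_def by blast
  have bd: "d n i j \<le> D" if "i \<in> I" "j \<in> I" for n i j
    unfolding d_def
    using mdist_le_of_mdiam_le[OF D(2)[OF range_subsetD[OF X]] D(1)] q that by blast
  have "\<exists>G. finite G \<and> G \<subseteq> L \<and> (\<forall>l\<in>L. \<exists>g\<in>G. \<forall>n. mdist (X n) (\<alpha> n l) (\<alpha> n g) < 1 / Suc k)"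
    for k :: nat
    by (rule equi) simp
  then obtain G where G: "\<And>k::nat. finite (G k)" "\<And>k. G k \<subseteq> L"
    "\<And>k l. l \<in> L \<Longrightarrow> \<exists>g\<in>G k. \<forall>n. mdist (X n) (\<alpha> n l) (\<alpha> n g) < 1 / Suc k"
    by metis
  \<comment> \<open>All net positions, together with the labels from the nets of precision
    \<open>1 / Suc k\<close> for every \<open>k\<close>: a countable set dense for all
    \<open>d n\<close> simultaneously.\<close>
  define C where "C = (UNIV :: nat set) <+> (\<Union>k. G k)"
  have C: "countable C" "C \<subseteq> I"
  proof -
    have "countable (\<Union>k. G k)" using G(1) by (auto intro: countable_finite)
    then show "countable C" by (simp add: C_def Plus_def)
    show "C \<subseteq> I" using G(2) by (auto simp: C_def I_def)
  qed
  have C_dense: "\<exists>c\<in>C. \<forall>n. d n i c < e" if "i \<in> I" "e > 0" for i e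
  proof (cases i)
    case (Inl k)
    have "d n i i = 0" for n unfolding d_def using q[OF \<open>i \<in> I\<close>] by simp
    then show ?thesis
      using \<open>e > 0\<close> Inl by (intro bexI[of _ i]) (auto simp: C_def)
  next
    case (Inr l)
    then have "l \<in> L" using \<open>i \<in> I\<close> by (auto simp: I_def)
    obtain k :: nat where "1 / Suc k < e" using nat_approx_posE[OF \<open>e > 0\<close>] by blast
    moreover obtain g where "g \<in> G k" "\<And>n. mdist (X n) (\<alpha> n l) (\<alpha> n g) < 1 / Suc k"
      using G(3)[OF \<open>l \<in> L\<close>] by blast
    ultimately show ?thesis
      using Inr by (intro bexI[of _ "Inr g"]) (auto simp: d_def q_def C_def intro: less_trans)
  qed
  obtain r where r: "strict_mono (r :: nat \<Rightarrow> nat)"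
    "\<And>i j. i \<in> I \<Longrightarrow> j \<in> I \<Longrightarrow> convergent (\<lambda>n. d (r n) i j)"
    using convergent_subsequence_of_pseudometrics[OF d bd C C_dense] by blast
  define \<rho> where "\<rho> = (\<lambda>i j. lim (\<lambda>n. d (r n) i j))"
  have lim: "(\<lambda>n. d (r n) i j) \<longlonglongrightarrow> \<rho> i j" if "i \<in> I" "j \<in> I" for i j
    using r(2)[OF that] unfolding \<rho>_def by (simp add: convergent_LIMSEQ_iff)
  have \<rho>: "pseudometric_on I \<rho>"
    using pseudometric_on_limit[of I "\<lambda>n. d (r n)" \<rho>] d lim by blast
  \<comment> \<open>A net common to all \<open>X n\<close> survives in the limit. If all of the
    finitely many \<open>k\<close> missed \<open>i\<close> by more than \<open>e\<close>, they would
    do so at some stage \<open>r n\<close>, where \<open>F\<close> is a net. The strict bound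
    becomes a weak one.\<close>
  have net: "\<exists>k\<in>F. \<rho> i (Inl k) \<le> e"
    if F: "finite F" "\<And>n x. x \<in> mspace (X n) \<Longrightarrow> \<exists>k\<in>F. mdist (X n) x (p n k) < e"
      and i: "i \<in> I" for F e i
  proof (rule ccontr)
    assume "\<not> (\<exists>k\<in>F. \<rho> i (Inl k) \<le> e)"
    then have "\<forall>\<^sub>F n in sequentially. e < d (r n) i (Inl k)" if "k \<in> F" for k
      using that i by (intro order_tendstoD(1)[OF lim]) (auto simp: I_def)
    then have "\<forall>\<^sub>F n in sequentially. \<forall>k\<in>F. e < d (r n) i (Inl k)"
      using F(1) by (intro eventually_ball_finite) auto
    then obtain n where "\<And>k. k \<in> F \<Longrightarrow> e < d (r n) i (Inl k)"
      by (auto simp: eventually_sequentially)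
    with F(2)[OF q[OF i, of "r n"]] show False
      by (auto simp: d_def q_def) (meson less_asym)
  qed
  have "\<exists>F. finite F \<and> F \<subseteq> I \<and> (\<forall>i\<in>I. \<exists>j\<in>F. \<rho> i j < e)" if "e > 0" for e
  proof -
    obtain F where F: "finite F"
      "\<And>n x. x \<in> mspace (X n) \<Longrightarrow> \<exists>k\<in>F. mdist (X n) x (p n k) < e / 2"
      using p(2)[of "e/2"] \<open>e > 0\<close> by auto
    have "\<exists>j\<in>Inl ` F. \<rho> i j < e" if "i \<in> I" for i
      using net[OF F that] \<open>e > 0\<close> by force
    then show ?thesis using F(1) by (intro exI[of _ "Inl ` F"]) (auto simp: I_def)
  qed
  then obtain K and b :: "nat + 'l \<Rightarrow> nat \<Rightarrow>\<^sub>C real" where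
    K: "compact K" "b ` I \<subseteq> K" "K \<subseteq> closure (b ` I)"
    and b: "\<And>i j. i \<in> I \<Longrightarrow> j \<in> I \<Longrightarrow> dist (b i) (b j) = \<rho> i j"
    using totally_bounded_pseudometric_embedding[OF \<rho>] by metis
  define Y where "Y = submetric euclidean_metric K"
  have Y: "mspace Y = K" "mdist Y = dist" by (simp_all add: Y_def)
  have cY: "compact_space (mtopology_of Y)"
    unfolding Y_def mtopology_of_submetric using K(1)
    by (simp add: compact_space_subtopology compactin_euclidean_iff)
  define \<beta> where "\<beta> = b \<circ> Inr"
  have \<beta>: "\<beta> l \<in> K" if "l \<in> L" for l
    using K(2) that by (auto simp: \<beta>_def I_def)
  have ev: "\<forall>\<^sub>F n in sequentially. lgh_dist L (X (r n), \<alpha> (r n)) (Y, \<beta>) \<le> ennreal (3 * e)"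
    if "e > 0" for e
  proof -
    \<comment> \<open>Precision \<open>e / 2\<close> leaves room for the points of \<open>K\<close>,
      which must first be approximated within \<open>e / 2\<close> by images of indices.\<close>
    obtain F where F: "finite F"
      "\<And>n x. x \<in> mspace (X n) \<Longrightarrow> \<exists>k\<in>F. mdist (X n) x (p n k) < e / 2"
      using p(2)[of "e/2"] \<open>e > 0\<close> by auto
    obtain H where H: "finite H" "H \<subseteq> L"
      "\<And>l. l \<in> L \<Longrightarrow> \<exists>g\<in>H. \<forall>n. mdist (X n) (\<alpha> n l) (\<alpha> n g) < e"
      using equi[OF \<open>e > 0\<close>] by blast
    \<comment> \<open>One finite index set serves as a net for points (\<open>F\<close>) and for
      labels (\<open>H\<close>). It is nonempty since \<open>F\<close> is a net of the nonempty
      space \<open>X 0\<close>.\<close>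
    define J where "J = F <+> H"
    have J: "finite J" "J \<subseteq> I" "J \<noteq> {}"
      using F(1) H(1,2) F(2) ne[of 0] by (auto simp: J_def I_def)
    have "\<forall>\<^sub>F n in sequentially. \<bar>d (r n) i j - \<rho> i j\<bar> < e" if "i \<in> J" "j \<in> J" for i j
      using tendstoD[OF lim \<open>e > 0\<close>, of i j] that J(2) by (auto simp: dist_real_def)
    \<comment> \<open>Finiteness of \<open>J\<close> makes the pointwise convergence uniform on
      \<open>J \<times> J\<close>; this is the distortion bound for the gluing.\<close>
    then have "\<forall>\<^sub>F n in sequentially. \<forall>i\<in>J. \<forall>j\<in>J. \<bar>d (r n) i j - \<rho> i j\<bar> < e"
      using J(1) by (simp add: eventually_ball_finite_distrib)
    then show ?thesis
    proof eventually_elim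
      case (elim n)
      show ?case
      proof (rule lgh_dist_le_of_correspondence[where a = "q (r n)" and b = b and J = J])
        show "q (r n) ` J \<subseteq> mspace (X (r n))" using q J(2) by auto
        show "b ` J \<subseteq> mspace Y" using K(2) J(2) by (auto simp: Y)
        show "\<bar>mdist (X (r n)) (q (r n) i) (q (r n) j) - mdist Y (b i) (b j)\<bar> \<le> e"
          if "i \<in> J" "j \<in> J" for i j
        proof -
          have "dist (b i) (b j) = \<rho> i j" using b that J(2) by blast
          then show ?thesis using elim that by (auto simp: Y d_def less_imp_le)
        qed
        show "\<exists>i\<in>J. mdist (X (r n)) x (q (r n) i) \<le> e" if x: "x \<in> mspace (X (r n))" for x
        proof -
          obtain k where "k \<in> F" "mdist (X (r n)) x (p (r n) k) < e / 2"
            using F(2)[OF x] by blast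
          then show ?thesis
            using \<open>e > 0\<close> by (intro bexI[of _ "Inl k"]) (auto simp: q_def J_def)
        qed
        show "\<exists>i\<in>J. mdist Y y (b i) \<le> e" if "y \<in> mspace Y" for y
        proof -
          have "y \<in> closure (b ` I)" using that K(3) by (auto simp: Y)
          then obtain i where i: "i \<in> I" "dist (b i) y < e / 2"
            using \<open>e > 0\<close> unfolding closure_approachable by (metis half_gt_zero imageE)
          obtain k where k: "k \<in> F" "\<rho> i (Inl k) \<le> e / 2" using net[OF F i(1)] by blast
          have "dist (b i) (b (Inl k)) \<le> e / 2"
            using b[OF i(1), of "Inl k"] k(2) InlI[of k UNIV L] by (simp add: I_def)
          then have "dist y (b (Inl k)) \<le> e"
            using dist_triangle3[of y "b (Inl k)" "b i"] i(2) by linarith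
          then show ?thesis using k(1) by (auto simp: Y J_def)
        qed
        show "\<alpha> (r n) l \<in> mspace (X (r n)) \<and> \<beta> l \<in> mspace Y \<and>
          (\<exists>i\<in>J. mdist (X (r n)) (\<alpha> (r n) l) (q (r n) i) \<le> e \<and> mdist Y (\<beta> l) (b i) \<le> e)"
          if l: "l \<in> L" for l
        proof -
          obtain g where g: "g \<in> H" "\<And>n. mdist (X n) (\<alpha> n l) (\<alpha> n g) < e"
            using H(3)[OF l] by blast
          have I: "Inr l \<in> I" "Inr g \<in> I" using l g(1) H(2) by (auto simp: I_def)
          \<comment> \<open>The same \<open>g\<close> is close to \<open>l\<close> for every
            \<open>n\<close>, so the estimate passes to the limit.\<close>
          have "\<rho> (Inr l) (Inr g) \<le> e"
            by (rule LIMSEQ_le_const2[OF lim[OF I]])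
               (use g(2) in \<open>auto simp: d_def q_def less_imp_le\<close>)
          then have "dist (\<beta> l) (b (Inr g)) \<le> e" using b[OF I] by (simp add: \<beta>_def)
          then show ?thesis
            using \<alpha>[OF l] \<beta>[OF l] g by (auto simp: Y J_def q_def less_imp_le intro!: bexI[of _ "Inr g"])
        qed
      qed (use J \<open>e > 0\<close> in auto)
    qed
  qed
  have "(\<lambda>n. lgh_dist L (X (r n), \<alpha> (r n)) (Y, \<beta>)) \<longlonglongrightarrow> 0"
  proof (rule order_tendstoI)
    fix u :: ennreal assume "0 < u"
    then obtain v where v: "0 < v" "v < u" using dense by blast
    then obtain e where e: "v = ennreal e" "e > 0"
      by (cases v) (auto simp: top.not_eq_extremum)
    show "\<forall>\<^sub>F n in sequentially. lgh_dist L (X (r n), \<alpha> (r n)) (Y, \<beta>) < u"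
      using ev[of "e/3"] e v by (auto elim!: eventually_mono)
  qed auto
  moreover have "labeled_metric_space L (Y, \<beta>)"
    using cY \<beta> by (simp add: labeled_metric_space_def Y)
  ultimately show ?thesis using that r(1) by blast
qed

section \<open>Equicontinuity over a compact label space\<close>

text \<open>The centers of a finite subcover by the given neighborhoods form the net. Here
  compactness of the label space becomes the finite condition used in constructing the
  limit.\<close>

lemma compact_equicontinuous_finite_net:
  assumes L: "compact_space (mtopology_of L)"
    and equi: "\<forall>l\<in>mspace L. \<forall>\<epsilon>>0. \<exists>U\<subseteq>mspace L. l \<in> mtopology_of L interior_of U \<and>
           (\<forall>l'\<in>U. \<forall>(X, \<alpha>)\<in>\<X>. mdist X (\<alpha> l) (\<alpha> l') < \<epsilon>)"
    and e: "\<epsilon> > 0"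
  shows "\<exists>G. finite G \<and> G \<subseteq> mspace L \<and>
    (\<forall>l\<in>mspace L. \<exists>g\<in>G. \<forall>(X, \<alpha>)\<in>\<X>. mdist X (\<alpha> l) (\<alpha> g) < \<epsilon>)"
proof -
  have "\<exists>U. l \<in> mtopology_of L interior_of U \<and>
      (\<forall>l'\<in>U. \<forall>(X, \<alpha>)\<in>\<X>. mdist X (\<alpha> l) (\<alpha> l') < \<epsilon>)" if l: "l \<in> mspace L" for l
  proof -
    obtain U where "l \<in> mtopology_of L interior_of U"
      "\<forall>l'\<in>U. \<forall>(X, \<alpha>)\<in>\<X>. mdist X (\<alpha> l) (\<alpha> l') < \<epsilon>"
      using equi[rule_format, OF l e] by (elim exE conjE)
    then show ?thesis by (intro exI conjI)
  qed
  then have "\<forall>l\<in>mspace L. \<exists>U. l \<in> mtopology_of L interior_of U \<and>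
      (\<forall>l'\<in>U. \<forall>(X, \<alpha>)\<in>\<X>. mdist X (\<alpha> l) (\<alpha> l') < \<epsilon>)" by (rule ballI)
  then obtain U where U: "\<forall>l\<in>mspace L. l \<in> mtopology_of L interior_of U l \<and>
      (\<forall>l'\<in>U l. \<forall>(X, \<alpha>)\<in>\<X>. mdist X (\<alpha> l) (\<alpha> l') < \<epsilon>)"
    by (rule bchoice[THEN exE]) (rule that)
  \<comment> \<open>The neighborhoods \<open>U l\<close> may fail to be open, so their interiors
    form the cover.\<close>
  define V where "V = (\<lambda>l. mtopology_of L interior_of U l)"
  have "\<forall>W\<in>V ` mspace L. openin (mtopology_of L) W" by (simp add: V_def)
  moreover have "topspace (mtopology_of L) \<subseteq> \<Union>(V ` mspace L)"
    using U by (auto simp: V_def)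
  ultimately obtain \<F> where \<F>: "finite \<F>" "\<F> \<subseteq> V ` mspace L" "mspace L \<subseteq> \<Union>\<F>"
    using L unfolding compact_space_alt topspace_mtopology_of by meson
  then obtain G where G: "finite G" "G \<subseteq> mspace L" "\<F> = V ` G"
    using finite_subset_image[OF \<F>(1,2)] by blast
  have "\<exists>g\<in>G. \<forall>(X, \<alpha>)\<in>\<X>. mdist X (\<alpha> l) (\<alpha> g) < \<epsilon>" if l: "l \<in> mspace L" for l
  proof -
    obtain g where g: "g \<in> G" "l \<in> V g" using \<F>(3) l G(3) by blast
    have "l \<in> U g" using g(2) subsetD[OF interior_of_subset] by (simp add: V_def)
    have "g \<in> mspace L" using g(1) G(2) by blast
    with U have "\<forall>l'\<in>U g. \<forall>(X, \<alpha>)\<in>\<X>. mdist X (\<alpha> g) (\<alpha> l') < \<epsilon>" by simp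
    then have "\<forall>(X, \<alpha>)\<in>\<X>. mdist X (\<alpha> g) (\<alpha> l) < \<epsilon>" using \<open>l \<in> U g\<close> by (rule bspec)
    then have "\<forall>(X, \<alpha>)\<in>\<X>. mdist X (\<alpha> l) (\<alpha> g) < \<epsilon>" by (simp add: mdist_commute)
    then show ?thesis using g(1) by (rule bexI)
  qed
  then show ?thesis using G by blast
qed

section \<open>Empty spaces and the passage to isometry classes\<close>

text \<open>All suprema range over empty sets and vanish, so the zero function is admissible for
  \<open>t = 0\<close>. This settles sequences with infinitely many empty spaces, which the
  construction of the limit excludes.\<close>

lemma lgh_dist_empty_spaces:
  assumes "mspace X = {}" "mspace Y = {}"
  shows "lgh_dist {} (X, \<alpha>) (Y, \<beta>) = 0"
proof -
  have "lgh_admissible 0 {} (X, \<alpha>) (Y, \<beta>) (\<lambda>_ _. 0)"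
    using assms by (simp add: lgh_admissible_def pseudometric_on_def hausdorff_dist_def bot_ennreal)
  then have "lgh_dist {} (X, \<alpha>) (Y, \<beta>) \<le> ennreal 0"
    unfolding lgh_dist_def by (intro Inf_lower) blast
  then show ?thesis by simp
qed

theorem corollary4p6:
  fixes L :: "'l metric"
    and \<X> :: "('l, 'a) labeled_space set"
  assumes "compact_space (mtopology_of L)"
    and "\<forall>P\<in>\<X>. labeled_metric_space (mspace L) P"
    and "uniformly_totally_bounded (fst ` \<X>)"
    and "\<forall>l\<in>mspace L. \<forall>\<epsilon>>0. \<exists>U\<subseteq>mspace L. l \<in> mtopology_of L interior_of U \<and>
           (\<forall>l'\<in>U. \<forall>(X, \<alpha>)\<in>\<X>. mdist X (\<alpha> l) (\<alpha> l') < \<epsilon>)"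
  shows "LGH_precompact (mspace L) (LGH_class (mspace L) ` \<X>)"
proof -
  let ?L = "mspace L"
  have "\<exists>(r :: nat \<Rightarrow> nat) C. strict_mono r \<and> C \<in> LGH_space ?L \<and>
          (\<lambda>n. LGH_space_dist ?L (\<sigma> (r n)) C) \<longlonglongrightarrow> 0"
    if \<sigma>: "range \<sigma> \<subseteq> LGH_class ?L ` \<X>" for \<sigma>
  proof -
    have "\<exists>P\<in>\<X>. \<sigma> n = LGH_class ?L P" for n using range_subsetD[OF \<sigma>, of n] by auto
    then obtain P where P: "\<And>n. P n \<in> \<X>" "\<And>n. \<sigma> n = LGH_class ?L (P n)" by metis
    have lP: "labeled_metric_space ?L (P n)" for n using P(1) assms(2) by blast
    define X where "X = (\<lambda>n. fst (P n))"
    define \<alpha> where "\<alpha> = (\<lambda>n. snd (P n))"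
    have PX: "P n = (X n, \<alpha> n)" for n by (simp add: X_def \<alpha>_def)
    have \<alpha>: "\<alpha> n l \<in> mspace (X n)" if "l \<in> ?L" for n l
      using lP[of n] that by (simp add: PX labeled_metric_space_def)
    \<comment> \<open>Either infinitely many of the spaces are nonempty and the construction applies
      to these, or infinitely many are empty and any one of them is the limit.\<close>
    show ?thesis
    proof (cases "infinite {n. mspace (X n) \<noteq> {}}")
      case True
      obtain s :: "nat \<Rightarrow> nat" where s: "strict_mono s" "\<And>n. mspace (X (s n)) \<noteq> {}"
        using infinite_enumerate[OF True] by auto
      have "\<exists>G. finite G \<and> G \<subseteq> ?L \<and>
          (\<forall>l\<in>?L. \<exists>g\<in>G. \<forall>n. mdist (X (s n)) (\<alpha> (s n) l) (\<alpha> (s n) g) < e)" if e: "e > 0" for e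
      proof -
        obtain G where "finite G" "G \<subseteq> ?L"
          "\<forall>l\<in>?L. \<exists>g\<in>G. \<forall>(X, \<alpha>)\<in>\<X>. mdist X (\<alpha> l) (\<alpha> g) < e"
          using compact_equicontinuous_finite_net[OF assms(1,4) e] by blast
        moreover have "(X (s n), \<alpha> (s n)) \<in> \<X>" for n using P(1)[of "s n"] by (simp add: PX)
        ultimately show ?thesis by (intro exI[of _ G]) blast
      qed
      moreover have "range (\<lambda>n. X (s n)) \<subseteq> fst ` \<X>"
        using P(1) by (auto simp: X_def)
      ultimately obtain r and Q :: "('l, nat \<Rightarrow>\<^sub>C real) labeled_space" where
        r: "strict_mono (r :: nat \<Rightarrow> nat)" and Q: "labeled_metric_space ?L Q"
        "(\<lambda>n. lgh_dist ?L (X (s (r n)), \<alpha> (s (r n))) Q) \<longlonglongrightarrow> 0"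
        using lgh_convergent_subsequence[of ?L "\<lambda>n. \<alpha> (s n)" "\<lambda>n. X (s n)" "fst ` \<X>"]
          \<alpha> assms(3) s(2) by blast
      \<comment> \<open>The distance of classes is that of any representatives, even ones over
        different point types, so \<open>Q\<close> may stay in the bounded sequences.\<close>
      have "(\<lambda>n. LGH_space_dist ?L (\<sigma> (s (r n))) (LGH_class ?L Q)) \<longlonglongrightarrow> 0"
        using Q(2) by (simp add: P(2) LGH_space_dist_class[OF lP Q(1)] PX[symmetric])
      moreover have "strict_mono (s \<circ> r)" using s(1) r by (rule strict_mono_o)
      ultimately show ?thesis
        using LGH_class_in_LGH_space[OF Q(1)]
        by (intro exI[of _ "s \<circ> r"] exI[of _ "LGH_class ?L Q"]) auto
    next
      case False
      then have inf: "infinite {n. mspace (X n) = {}}"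
        using finite_Collect_not[of "\<lambda>n. mspace (X n) = {}"] by auto
      obtain s :: "nat \<Rightarrow> nat" where s: "strict_mono s" "\<And>n. mspace (X (s n)) = {}"
        using infinite_enumerate[OF inf] by auto
      \<comment> \<open>A label would be sent to a point of an empty space.\<close>
      have "?L = {}" using \<alpha>[of _ "s 0"] s(2)[of 0] by auto
      then have "LGH_space_dist ?L (\<sigma> (s n)) (LGH_class ?L (P (s 0))) = 0" for n
        using lgh_dist_empty_spaces[OF s(2) s(2)] lP
        by (simp add: P(2) LGH_space_dist_class PX)
      then show ?thesis
        using s(1) LGH_class_in_LGH_space[OF lP[of "s 0"]]
        by (intro exI[of _ s] exI[of _ "LGH_class ?L (P (s 0))"]) auto
    qed
  qed
  moreover have "LGH_class ?L ` \<X> \<subseteq> LGH_space ?L"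
    using assms(2) LGH_class_in_LGH_space by blast
  ultimately show ?thesis unfolding LGH_precompact_def by blast
qed

end
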